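(* Let $G=(V,E,\vartheta,w)$ be a connected finite or locally finite weighted graph equipped with the standard Laplace operator $\Delta$. For any positive function $u:V\to\mathbb{R}^+$ and any variable exponent $m:V\times[0,\infty)\to\mathbb{R}^+$, the following identity holds at each vertex $x\in V$: $$\Delta(u^{m(x,t)})(x)=2u^{\frac{m(x,t)}{2}}(x)\,\Delta(u^{\frac{m(x,t)}{2}})(x)+2\Gamma(u^{\frac{m(x,t)}{2}})(x).$$
   Context: $G$ has vertex set $V$, edge set $E$, vertex measure $\vartheta:V\to(0,\infty)$ and symmetric edge weights $w_{xy}=w_{yx}>0$ if $x\sim y$ (adjacent), $w_{xy}=0$ otherwise. Locally finite: every vertex has finitely many neighbors. For $f:V\to\mathbb{R}$, $$\Delta f(x)=\frac{1}{\vartheta(x)}\sum_{y\sim x}w_{xy}(f(y)-f(x)),\qquad \Gamma(f)(x)=\frac{1}{2\vartheta(x)}\sum_{y\sim x}w_{xy}(f(y)-f(x))^2.$$ Notation: for fixed $t\ge0$, $u^{m(x,t)}$ denotes the function $x\mapsto u(x)^{m(x,t)}$ on $V$, and $u^{m(x,t)/2}$ denotes $x\mapsto u(x)^{m(x,t)/2}$ (the exponent is evaluated at the same vertex as $u$). *)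

theory Defs
  imports Complex_Main "Graph_Theory.Graph_Theory"
begin

text \<open>
  A graph is a symmetric set of pairs \<open>parcs G\<close> over the vertex set \<open>pverts G\<close>, so there are no
  parallel edges and adjacency \<open>x \<sim> y\<close> reads \<open>(x, y) \<in> parcs G\<close>. Loops are permitted.
  Functions on \<open>V\<close> are total HOL functions of which only the values on \<open>pverts G\<close> matter.
\<close>

locale weighted_graph = pair_sym_digraph G
  for G :: "'a pair_pre_digraph" +
  fixes \<theta> :: "'a \<Rightarrow> real" and w :: "'a \<Rightarrow> 'a \<Rightarrow> real"
  assumes measure_pos: "x \<in> pverts G \<Longrightarrow> \<theta> x > 0"
    and weight_sym: "\<lbrakk>x \<in> pverts G; y \<in> pverts G\<rbrakk> \<Longrightarrow> w x y = w y x"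
    and weight_pos: "(x, y) \<in> parcs G \<Longrightarrow> w x y > 0"
    and weight_zero: "\<lbrakk>x \<in> pverts G; y \<in> pverts G; (x, y) \<notin> parcs G\<rbrakk> \<Longrightarrow> w x y = 0"

definition locally_finite :: "'a pair_pre_digraph \<Rightarrow> bool" where
  "locally_finite G \<longleftrightarrow> (\<forall>x \<in> pverts G. finite {y. (x, y) \<in> parcs G})"

definition laplacian ::
  "'a pair_pre_digraph \<Rightarrow> ('a \<Rightarrow> real) \<Rightarrow> ('a \<Rightarrow> 'a \<Rightarrow> real) \<Rightarrow> ('a \<Rightarrow> real) \<Rightarrow> 'a \<Rightarrow> real" where
  "laplacian G \<theta> w f x = 1 / \<theta> x * (\<Sum>y | (x, y) \<in> parcs G. w x y * (f y - f x))"

definition carre_du_champ ::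
  "'a pair_pre_digraph \<Rightarrow> ('a \<Rightarrow> real) \<Rightarrow> ('a \<Rightarrow> 'a \<Rightarrow> real) \<Rightarrow> ('a \<Rightarrow> real) \<Rightarrow> 'a \<Rightarrow> real" where
  "carre_du_champ G \<theta> w f x = 1 / (2 * \<theta> x) * (\<Sum>y | (x, y) \<in> parcs G. w x y * (f y - f x)\<^sup>2)"

end

theory Submission
  imports Defs
begin

text \<open>
  With \<open>f = u powr (m / 2)\<close>, the exponent being read at the same vertex as \<open>u\<close>, the function
  \<open>u powr m\<close> is the pointwise square of \<open>f\<close>. So the variable exponent disappears, and the
  identity is the product rule \<open>\<Delta> (f\<^sup>2) = 2 f \<Delta> f + 2 \<Gamma> f\<close>: the Laplacian fails
  the Leibniz rule exactly by the carre du champ. That rule, \<open>laplacian_square\<close>, holds already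
  for the contribution of each single edge, because
  \<open>b\<^sup>2 - a\<^sup>2 = 2 a (b - a) + (b - a)\<^sup>2\<close>.
\<close>

lemma laplacian_square:
  "laplacian G \<theta> w (\<lambda>y. (f y)\<^sup>2) x =
    2 * f x * laplacian G \<theta> w f x + 2 * carre_du_champ G \<theta> w f x"
proof -
  have "(\<Sum>y | (x, y) \<in> parcs G. w x y * ((f y)\<^sup>2 - (f x)\<^sup>2)) =
      (\<Sum>y | (x, y) \<in> parcs G. 2 * f x * (w x y * (f y - f x)) + w x y * (f y - f x)\<^sup>2)"
    by (intro sum.cong refl) (simp add: power2_eq_square algebra_simps)
  also have "\<dots> = 2 * f x * (\<Sum>y | (x, y) \<in> parcs G. w x y * (f y - f x)) +
      (\<Sum>y | (x, y) \<in> parcs G. w x y * (f y - f x)\<^sup>2)"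
    by (simp add: sum.distrib sum_distrib_left)
  finally show ?thesis
    by (simp add: laplacian_def carre_du_champ_def add_divide_distrib)
qed

lemma powr_eq_square_powr_half:
  fixes a p :: real
  shows "a powr p = (a powr (p / 2))\<^sup>2"
  by (simp add: power2_eq_square flip: powr_add)

theorem lemma3p2:
  fixes G :: "'a pair_pre_digraph"
    and \<theta> :: "'a \<Rightarrow> real" and w :: "'a \<Rightarrow> 'a \<Rightarrow> real"
    and u :: "'a \<Rightarrow> real" and m :: "'a \<Rightarrow> real \<Rightarrow> real"
  assumes "weighted_graph G \<theta> w"
    and "connected (with_proj G)"
    and "finite (pverts G) \<or> locally_finite G"
    and "\<And>x. x \<in> pverts G \<Longrightarrow> u x > 0"
    and "\<And>x t. \<lbrakk>x \<in> pverts G; t \<ge> 0\<rbrakk> \<Longrightarrow> m x t > 0"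
  shows "\<forall>t \<ge> 0. \<forall>x \<in> pverts G.
    laplacian G \<theta> w (\<lambda>y. u y powr m y t) x =
      2 * u x powr (m x t / 2) * laplacian G \<theta> w (\<lambda>y. u y powr (m y t / 2)) x
      + 2 * carre_du_champ G \<theta> w (\<lambda>y. u y powr (m y t / 2)) x"
proof (intro allI impI ballI)
  fix t x
  have "(\<lambda>y. u y powr m y t) = (\<lambda>y. (u y powr (m y t / 2))\<^sup>2)"
    by (rule ext) (rule powr_eq_square_powr_half)
  then show "laplacian G \<theta> w (\<lambda>y. u y powr m y t) x =
      2 * u x powr (m x t / 2) * laplacian G \<theta> w (\<lambda>y. u y powr (m y t / 2)) x
      + 2 * carre_du_champ G \<theta> w (\<lambda>y. u y powr (m y t / 2)) x"
    by (simp only: laplacian_square)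
qed

end
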